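(* Assume that $\mathcal A$ is compact; that for each $\xi\in\Xi$, $\mathcal C(s,a,\xi)$ and $g(s,a,\xi)$ are continuous in $(s,a)$; and that there are constants $\bar{\mathcal C}_w>0$, $\kappa_w\ge0$ such that $|\mathcal C(s,a,\xi)|\le\bar{\mathcal C}_ww(s)$ and $w(g(s,a,\xi))\le\kappa_ww(s)$ for all $(s,a,\xi)\in\mathcal S\times\mathcal A\times\Xi$, with $\gamma_w:=\gamma\kappa_w<1$. Let $C^N_{s,a}(\xi):=\mathcal C(s,a,\xi)+\gamma\hat V_N^*(g(s,a,\xi))$. Then: (i) For any $\epsilon>0$ and fixed $\bar s\in\mathcal S$, there exists $\delta>0$ (depending on $\epsilon$ and $\bar s$) such that $\mathbb D(\tilde{\mathcal A}_N^*(\bar s),\hat{\mathcal A}_N^*(\bar s);\mathsf d_E)<\epsilon$ when $\mathbb H(\mathfrak P(\hat P_N,\hat r_N),\mathfrak P(\tilde P_N,\tilde r_N);\mathsf d_{TV})<\delta$. (ii) If, in addition, the second-order growth condition holds, that is, for any given $\bar s\in\mathcal S$ there exists a positive constant $\nu$ such that $$\sup_{P\in\mathfrak P(\hat P_N,\hat r_N)}\mathbb E_P[C^N_{\bar s,a}(\xi)]\ge\hat V_N^*(\bar s)+\nu\,\mathsf d_E(a,\hat{\mathcal A}_N^*(\bar s))^2\quad\text{for all }a\in\mathcal A,$$ then $$\mathbb D(\tilde{\mathcal A}_N^*(\bar s),\hat{\mathcal A}_N^*(\bar s);\mathsf d_E)\le\sqrt{\frac{3\bar{\mathcal C}_ww(\bar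 s)}{\nu(1-\gamma_w)^2}\,\mathbb H(\mathfrak P(\hat P_N,\hat r_N),\mathfrak P(\tilde P_N,\tilde r_N);\mathsf d_{TV})}.$$
   Context: $\mathcal S\subseteq\mathbb R^m$ and $\mathcal A\subseteq\mathbb R^n$ are nonempty closed sets; $\Xi=\{\xi^1,\dots,\xi^J\}\subseteq\mathbb R^k$ is a finite set of $J$ distinct points; $\mathscr P(\Xi)$ is the set of probability measures on $\Xi$, identified with the probability vectors $\{P=(p_j)_{j=1}^J\in[0,1]^J:\sum_{j=1}^Jp_j=1\}$ via $p_j=P(\xi=\xi^j)$. $\mathcal C:\mathcal S\times\mathcal A\times\Xi\to\mathbb R$ is the cost, $g:\mathcal S\times\mathcal A\times\Xi\to\mathcal S$ the transition function, $\gamma\in[0,1)$ the discount factor. Ambiguity sets: $(\hat\xi_1,\dots,\hat\xi_N)$ and $(\tilde\xi_1,\dots,\tilde\xi_N)$ are two sample sets in $\Xi^N$ (clean, and perturbed). Prior parameters $\tau_{j,0}>1$, $\alpha\in(0,1)$, $\alpha'=\alpha/J$ are fixed and $z_{1-\alpha'/2}$ is the $(1-\alpha'/2)$-quantile of the standard normal distribution. Define $$\hat p_{j,N}=\frac{\tau_{j,0}-1+\sum_{i=1}^N\mathbf 1_{\{\hat\xi_i=\xi^j\}}}{\sum_{k=1}^J\tau_{k,0}-J+N},\qquad \hat r_{j,N}=z_{1-\alpha'/2}\sqrt{\frac{\hat p_{j,N}(1-\hat p_{j,N})}{\sum_{k=1}^J\tau_{k,0}-J+N}},$$ and $\tilde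 p_{j,N},\tilde r_{j,N}$ by the same formulas with $\tilde\xi_i$ in place of $\hat\xi_i$ (and $\tilde p_{j,N}$ in place of $\hat p_{j,N}$); $\hat P_N,\hat r_N,\tilde P_N,\tilde r_N$ are the corresponding vectors, and $\mathfrak P(P,r)=\{Q\in\mathscr P(\Xi):p_j-r_j\le q_j\le p_j+r_j,\ j=1,\dots,J\}$. Weighted norm: $w:\mathcal S\to[1,\infty)$ is a fixed continuous function, $\|V\|_w=\sup_{s\in\mathcal S}|V(s)|/w(s)$, and $\mathscr V(\mathcal S)=\{V:\mathcal S\to\mathbb R:\|V\|_w<\infty\}$. $\hat V_N^*$ and $\tilde V_N^*$ are the unique fixed points in $\mathscr V(\mathcal S)$ of $$\hat{\mathcal L}_N(V)(s)=\inf_{a\in\mathcal A}\sup_{P\in\mathfrak P(\hat P_N,\hat r_N)}\mathbb E_P[\mathcal C(s,a,\xi)+\gamma V(g(s,a,\xi))],\qquad \tilde{\mathcal L}_N(V)(s)=\inf_{a\in\mathcal A}\sup_{P\in\mathfrak P(\tilde P_N,\tilde r_N)}\mathbb E_P[\mathcal C(s,a,\xi)+\gamma V(g(s,a,\xi))].$$ $\hat{\mathcal A}_N^*(s)$ (resp. $\tilde{\mathcal A}_N^*(s)$) is the set of $a\in\mathcal A$ attaining the infimum in $\hat{\mathcal L}_N(\hat V_N^* )(s)$ (resp. in $\tilde{\mathcal L}_N(\tilde V_N^* )(s)$). Metrics: $\mathsf d_E$ is the Euclidean metric on $\mathcal A$, with $\mathsf d_E(a,S)=\inf_{b\in S}\mathsf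 d_E(a,b)$; $\mathsf d_{TV}(P,Q)=\sup\{|\mathbb E_P[h(\xi)]-\mathbb E_Q[h(\xi)]|:h:\mathrm{conv}\,\Xi\to\mathbb R,\ \sup|h|\le1\}$. For a metric $\mathsf d$, $\mathbb D(S_1,S_2;\mathsf d)=\sup_{x\in S_1}\inf_{y\in S_2}\mathsf d(x,y)$ and $\mathbb H(S_1,S_2;\mathsf d)=\max\{\mathbb D(S_1,S_2;\mathsf d),\mathbb D(S_2,S_1;\mathsf d)\}$. *)

theory Defs
  imports "HOL-Probability.Probability"
begin

text \<open>
  A finite set of \<open>J\<close> distinct points is given by an injective map \<open>\<xi> :: 'j \<Rightarrow> _\<close> on a finite index
  type, so \<open>J = CARD('j)\<close>; probability measures on it are vectors indexed by \<open>'j\<close>.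
\<close>

definition prob_vectors :: "(real ^ 'j::finite) set" where
  "prob_vectors = {P. (\<forall>j. 0 \<le> P $ j \<and> P $ j \<le> 1) \<and> (\<Sum>j\<in>UNIV. P $ j) = 1}"

definition expect :: "('j::finite \<Rightarrow> 'x) \<Rightarrow> real ^ 'j \<Rightarrow> ('x \<Rightarrow> real) \<Rightarrow> real" where
  "expect \<xi> P h = (\<Sum>j\<in>UNIV. P $ j * h (\<xi> j))"

definition box_ambiguity :: "real ^ 'j::finite \<Rightarrow> real ^ 'j \<Rightarrow> (real ^ 'j) set" where
  "box_ambiguity P r = {Q \<in> prob_vectors. \<forall>j. P $ j - r $ j \<le> Q $ j \<and> Q $ j \<le> P $ j + r $ j}"

definition quantile :: "real measure \<Rightarrow> real \<Rightarrow> real" where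
  "quantile M p = Inf {x. p \<le> cdf M x}"

definition est_denom :: "real ^ 'j::finite \<Rightarrow> nat \<Rightarrow> real" where
  "est_denom \<tau> N = (\<Sum>k\<in>UNIV. \<tau> $ k) - real CARD('j) + real N"

definition est_p :: "('j::finite \<Rightarrow> 'x) \<Rightarrow> real ^ 'j \<Rightarrow> nat \<Rightarrow> (nat \<Rightarrow> 'x) \<Rightarrow> real ^ 'j" where
  "est_p \<xi> \<tau> N x =
     (\<chi> j. (\<tau> $ j - 1 + (\<Sum>i=1..N. if x i = \<xi> j then 1 else 0)) / est_denom \<tau> N)"

definition est_r ::
  "('j::finite \<Rightarrow> 'x) \<Rightarrow> real ^ 'j \<Rightarrow> real \<Rightarrow> nat \<Rightarrow> (nat \<Rightarrow> 'x) \<Rightarrow> real ^ 'j" where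
  "est_r \<xi> \<tau> \<alpha> N x =
     (let \<alpha>' = \<alpha> / real CARD('j);
          z = quantile std_normal_distribution (1 - \<alpha>' / 2);
          p = est_p \<xi> \<tau> N x
      in (\<chi> j. z * sqrt (p $ j * (1 - p $ j) / est_denom \<tau> N)))"

definition est_ambiguity ::
  "('j::finite \<Rightarrow> 'x) \<Rightarrow> real ^ 'j \<Rightarrow> real \<Rightarrow> nat \<Rightarrow> (nat \<Rightarrow> 'x) \<Rightarrow> (real ^ 'j) set" where
  "est_ambiguity \<xi> \<tau> \<alpha> N x = box_ambiguity (est_p \<xi> \<tau> N x) (est_r \<xi> \<tau> \<alpha> N x)"

text \<open>
  Functions on \<open>S\<close> are represented as members of \<^term>\<open>extensional S\<close>, so that a fixed point is
  determined by its values on \<open>S\<close>. The \<^term>\<open>bdd_above\<close> condition says that the weighted norm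
  is finite.
\<close>

definition weighted_space :: "'s set \<Rightarrow> ('s \<Rightarrow> real) \<Rightarrow> ('s \<Rightarrow> real) set" where
  "weighted_space S w = {V \<in> extensional S. bdd_above ((\<lambda>s. \<bar>V s\<bar> / w s) ` S)}"

definition cost_to_go ::
  "('s \<Rightarrow> 'a \<Rightarrow> 'x \<Rightarrow> real) \<Rightarrow> ('s \<Rightarrow> 'a \<Rightarrow> 'x \<Rightarrow> 's) \<Rightarrow> real \<Rightarrow> ('s \<Rightarrow> real) \<Rightarrow> 's \<Rightarrow> 'a \<Rightarrow> 'x \<Rightarrow> real" where
  "cost_to_go C g \<gamma> V s a x = C s a x + \<gamma> * V (g s a x)"

definition worst_case :: "('j::finite \<Rightarrow> 'x) \<Rightarrow> (real ^ 'j) set \<Rightarrow> ('x \<Rightarrow> real) \<Rightarrow> real" where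
  "worst_case \<xi> \<PP> h = (SUP P\<in>\<PP>. expect \<xi> P h)"

definition robust_bellman ::
  "'s set \<Rightarrow> 'a set \<Rightarrow> ('j::finite \<Rightarrow> 'x) \<Rightarrow> ('s \<Rightarrow> 'a \<Rightarrow> 'x \<Rightarrow> real) \<Rightarrow> ('s \<Rightarrow> 'a \<Rightarrow> 'x \<Rightarrow> 's) \<Rightarrow>
   real \<Rightarrow> (real ^ 'j) set \<Rightarrow> ('s \<Rightarrow> real) \<Rightarrow> 's \<Rightarrow> real" where
  "robust_bellman S A \<xi> C g \<gamma> \<PP> V =
     (\<lambda>s\<in>S. INF a\<in>A. worst_case \<xi> \<PP> (cost_to_go C g \<gamma> V s a))"

definition value_function ::
  "'s set \<Rightarrow> 'a set \<Rightarrow> ('j::finite \<Rightarrow> 'x) \<Rightarrow> ('s \<Rightarrow> 'a \<Rightarrow> 'x \<Rightarrow> real) \<Rightarrow> ('s \<Rightarrow> 'a \<Rightarrow> 'x \<Rightarrow> 's) \<Rightarrow>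
   real \<Rightarrow> ('s \<Rightarrow> real) \<Rightarrow> (real ^ 'j) set \<Rightarrow> 's \<Rightarrow> real" where
  "value_function S A \<xi> C g \<gamma> w \<PP> =
     (THE V. V \<in> weighted_space S w \<and> robust_bellman S A \<xi> C g \<gamma> \<PP> V = V)"

definition optimal_actions ::
  "'s set \<Rightarrow> 'a set \<Rightarrow> ('j::finite \<Rightarrow> 'x) \<Rightarrow> ('s \<Rightarrow> 'a \<Rightarrow> 'x \<Rightarrow> real) \<Rightarrow> ('s \<Rightarrow> 'a \<Rightarrow> 'x \<Rightarrow> 's) \<Rightarrow>
   real \<Rightarrow> ('s \<Rightarrow> real) \<Rightarrow> (real ^ 'j) set \<Rightarrow> 's \<Rightarrow> 'a set" where
  "optimal_actions S A \<xi> C g \<gamma> w \<PP> s =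
     (let V = value_function S A \<xi> C g \<gamma> w \<PP>
      in {a \<in> A. worst_case \<xi> \<PP> (cost_to_go C g \<gamma> V s a) = robust_bellman S A \<xi> C g \<gamma> \<PP> V s})"

definition tv_dist ::
  "('j::finite \<Rightarrow> 'x::real_vector) \<Rightarrow> real ^ 'j \<Rightarrow> real ^ 'j \<Rightarrow> real" where
  "tv_dist \<xi> P Q =
     (SUP h\<in>{h. \<forall>x\<in>convex hull (range \<xi>). \<bar>h x\<bar> \<le> 1}. \<bar>expect \<xi> P h - expect \<xi> Q h\<bar>)"

text \<open>
  The suprema and infima below are taken in \<^typ>\<open>real\<close>, so they are meaningful only for nonempty
  sets between which the distance is bounded.
\<close>

definition excess_dist :: "('a \<Rightarrow> 'a \<Rightarrow> real) \<Rightarrow> 'a set \<Rightarrow> 'a set \<Rightarrow> real" where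
  "excess_dist d X Y = (SUP x\<in>X. INF y\<in>Y. d x y)"

definition hausdorff_dist :: "('a \<Rightarrow> 'a \<Rightarrow> real) \<Rightarrow> 'a set \<Rightarrow> 'a set \<Rightarrow> real" where
  "hausdorff_dist d X Y = max (excess_dist d X Y) (excess_dist d Y X)"

end

theory Submission
  imports Defs
begin

text \<open>
  Write \<open>\<eta>\<close> for the Hausdorff distance of the two ambiguity sets and \<open>K = C\<^sub>w / (1 - \<gamma>\<^sub>w)\<close>. Both
  Bellman operators are \<open>\<gamma>\<^sub>w\<close>-contractions in the weighted norm and their fixed points have norm at
  most \<open>K\<close>, hence so do the integrands \<open>C + \<gamma> V\<close>, and replacing one ambiguity set by the other changes
  a worst-case expectation of such an integrand by at most \<open>K \<eta> w(s)\<close>. The value functions therefore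
  differ by at most \<open>D = K \<eta> w(s) / (1 - \<gamma>\<^sub>w)\<close>, and an action that is optimal for the perturbed problem
  is \<open>2 D\<close>-optimal for the original one, the errors adding up to
  \<open>D + \<gamma>\<^sub>w D + (1 - \<gamma>\<^sub>w) D\<close>. Part (i) follows because, by compactness, the objective exceeds its minimum
  by a fixed gap away from the optimal actions, and part (ii) because the growth condition makes that
  gap quadratic. The value iterates are continuous and converge uniformly relative to \<open>w\<close>, so the
  value function is continuous and optimal actions exist; this matters since suprema over the empty
  set are junk in \<^typ>\<open>real\<close>.
\<close>

subsection \<open>Worst-case expectations\<close>

lemma expect_le_add:
  assumes "P \<in> prob_vectors" and "\<And>j. h (\<xi> j) \<le> h' (\<xi> j) + d"
  shows "expect \<xi> P h \<le> expect \<xi> P h' + d"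
proof -
  have "expect \<xi> P h \<le> (\<Sum>j\<in>UNIV. P $ j * (h' (\<xi> j) + d))"
    unfolding expect_def using assms by (intro sum_mono mult_left_mono) (auto simp: prob_vectors_def)
  also have "\<dots> = expect \<xi> P h' + (\<Sum>j\<in>UNIV. P $ j) * d"
    by (simp add: expect_def distrib_left sum.distrib sum_distrib_right)
  finally show ?thesis using assms(1) by (simp add: prob_vectors_def)
qed

text \<open>The finite support gives one bound for all \<open>P\<close>; without it the suprema in
  \<open>worst_case\<close> would be meaningless in \<open>real\<close>.\<close>

lemma bdd_above_expect:
  assumes "PP \<subseteq> prob_vectors"
  shows "bdd_above ((\<lambda>P. expect \<xi> P h) ` PP)"
proof (rule bdd_aboveI2)
  fix P assume "P \<in> PP"
  have "expect \<xi> P h \<le> expect \<xi> P (\<lambda>_. 0) + (\<Sum>j\<in>UNIV. \<bar>h (\<xi> j)\<bar>)"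
  proof (rule expect_le_add)
    show "P \<in> prob_vectors" using \<open>P \<in> PP\<close> assms by blast
    show "h (\<xi> j) \<le> 0 + (\<Sum>j\<in>UNIV. \<bar>h (\<xi> j)\<bar>)" for j
      using member_le_sum[of j UNIV "\<lambda>j. \<bar>h (\<xi> j)\<bar>"] by auto
  qed
  then show "expect \<xi> P h \<le> (\<Sum>j\<in>UNIV. \<bar>h (\<xi> j)\<bar>)" by (simp add: expect_def)
qed

lemma worst_case_le_add:
  assumes "PP \<subseteq> prob_vectors" "PP \<noteq> {}" and "\<And>j. h (\<xi> j) \<le> h' (\<xi> j) + d"
  shows "worst_case \<xi> PP h \<le> worst_case \<xi> PP h' + d"
  unfolding worst_case_def
proof (rule cSUP_least[OF assms(2)])
  fix P assume P: "P \<in> PP"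
  have "expect \<xi> P h \<le> expect \<xi> P h' + d"
    using P assms by (intro expect_le_add) auto
  also have "expect \<xi> P h' \<le> (SUP P\<in>PP. expect \<xi> P h')"
    by (rule cSUP_upper[OF P bdd_above_expect[OF assms(1)]])
  finally show "expect \<xi> P h \<le> (SUP P\<in>PP. expect \<xi> P h') + d" by simp
qed

lemma worst_case_diff_le:
  assumes "PP \<subseteq> prob_vectors" "PP \<noteq> {}" and "\<And>j. \<bar>h (\<xi> j) - h' (\<xi> j)\<bar> \<le> d"
  shows "\<bar>worst_case \<xi> PP h - worst_case \<xi> PP h'\<bar> \<le> d"
proof -
  have "h (\<xi> j) \<le> h' (\<xi> j) + d" "h' (\<xi> j) \<le> h (\<xi> j) + d" for j
    using assms(3)[of j] by auto
  then show ?thesis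
    using worst_case_le_add[OF assms(1,2), of h \<xi> h' d] worst_case_le_add[OF assms(1,2), of h' \<xi> h d]
    by auto
qed

lemma abs_worst_case_le:
  assumes "PP \<subseteq> prob_vectors" "PP \<noteq> {}" and "\<And>j. \<bar>h (\<xi> j)\<bar> \<le> d"
  shows "\<bar>worst_case \<xi> PP h\<bar> \<le> d"
proof -
  have "worst_case \<xi> PP (\<lambda>_. 0) = 0" using assms(2) by (simp add: worst_case_def expect_def)
  then show ?thesis
    using worst_case_diff_le[OF assms(1,2), of h \<xi> "\<lambda>_. 0" d] assms(3) by simp
qed

section \<open>Total variation distance and its Hausdorff excess\<close>

lemma abs_expect_le:
  assumes "P \<in> prob_vectors" and "\<And>j. \<bar>h (\<xi> j)\<bar> \<le> M"
  shows "\<bar>expect \<xi> P h\<bar> \<le> M"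
proof -
  have M: "h (\<xi> j) \<le> 0 + M" "0 \<le> h (\<xi> j) + M" for j
    using assms(2)[of j] by auto
  show ?thesis
    using expect_le_add[OF assms(1), of h \<xi> "\<lambda>_. 0" M] expect_le_add[OF assms(1), of "\<lambda>_. 0" \<xi> h M] M
    by (simp add: expect_def abs_le_iff)
qed

lemma expect_diff_bound:
  assumes "P \<in> prob_vectors" "Q \<in> prob_vectors" and "\<And>j. \<bar>h (\<xi> j)\<bar> \<le> M"
  shows "\<bar>expect \<xi> P h - expect \<xi> Q h\<bar> \<le> 2 * M"
  using abs_expect_le[of P h \<xi> M] abs_expect_le[of Q h \<xi> M] assms by auto

lemma bdd_above_tv_dist:
  assumes "P \<in> prob_vectors" "Q \<in> prob_vectors"
  shows "bdd_above ((\<lambda>h. \<bar>expect \<xi> P h - expect \<xi> Q h\<bar>) `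
           {h. \<forall>x\<in>convex hull (range \<xi>). \<bar>h x\<bar> \<le> 1})"
proof (rule bdd_aboveI2)
  fix h :: "'b \<Rightarrow> real" assume "h \<in> {h. \<forall>x\<in>convex hull (range \<xi>). \<bar>h x\<bar> \<le> 1}"
  then have "\<bar>h (\<xi> j)\<bar> \<le> 1" for j by (auto simp: hull_inc)
  then show "\<bar>expect \<xi> P h - expect \<xi> Q h\<bar> \<le> 2"
    using expect_diff_bound[OF assms, of h \<xi> 1] by simp
qed

lemma tv_dist_le_2:
  assumes "P \<in> prob_vectors" "Q \<in> prob_vectors"
  shows "tv_dist \<xi> P Q \<le> 2"
  unfolding tv_dist_def
proof (rule cSUP_least)
  show "{h. \<forall>x\<in>convex hull (range \<xi>). \<bar>h x\<bar> \<le> (1::real)} \<noteq> {}"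
    by (auto intro!: exI[of _ "\<lambda>_. 0"])
  fix h :: "'b \<Rightarrow> real" assume "h \<in> {h. \<forall>x\<in>convex hull (range \<xi>). \<bar>h x\<bar> \<le> 1}"
  then have "\<bar>h (\<xi> j)\<bar> \<le> 1" for j by (auto simp: hull_inc)
  then show "\<bar>expect \<xi> P h - expect \<xi> Q h\<bar> \<le> 2"
    using expect_diff_bound[OF assms, of h \<xi> 1] by simp
qed

lemma expect_diff_le_tv_dist:
  assumes "P \<in> prob_vectors" "Q \<in> prob_vectors" and M: "0 < M" "\<And>j. \<bar>h (\<xi> j)\<bar> \<le> M"
  shows "\<bar>expect \<xi> P h - expect \<xi> Q h\<bar> \<le> M * tv_dist \<xi> P Q"
proof -
  \<comment> \<open>Admissible test functions are bounded by 1 on the whole convex hull, while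
    \<open>h\<close> is controlled only at the points: scale by \<open>M\<close> and cut off
    elsewhere, which expectations do not see.\<close>
  define h' where "h' x = (if x \<in> range \<xi> then h x / M else 0)" for x
  have h: "h' \<in> {h. \<forall>x\<in>convex hull (range \<xi>). \<bar>h x\<bar> \<le> 1}"
    using M by (auto simp: h'_def)
  have "expect \<xi> R h = M * expect \<xi> R h'" for R
    using M(1) by (simp add: expect_def h'_def sum_distrib_left)
  then have "\<bar>expect \<xi> P h - expect \<xi> Q h\<bar> = M * \<bar>expect \<xi> P h' - expect \<xi> Q h'\<bar>"
    using M(1) by (simp add: abs_mult flip: right_diff_distrib)
  also have "\<dots> \<le> M * tv_dist \<xi> P Q"
    unfolding tv_dist_def using M(1)
    by (intro mult_left_mono cSUP_upper[OF h bdd_above_tv_dist[OF assms(1,2)]]) auto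
  finally show ?thesis .
qed

lemma tv_dist_nonneg:
  assumes "P \<in> prob_vectors" "Q \<in> prob_vectors"
  shows "0 \<le> tv_dist \<xi> P Q"
  using expect_diff_le_tv_dist[OF assms, of 1 "\<lambda>_. 0" \<xi>] by simp

text \<open>The supremum in \<open>excess_dist\<close> is over a bounded set because distances of
  probability vectors are at most 2.\<close>

lemma INF_tv_dist_le_excess_dist:
  assumes P: "PP \<subseteq> prob_vectors" and Q: "QQ \<subseteq> prob_vectors" "QQ \<noteq> {}" and p: "p \<in> PP"
  shows "(INF q\<in>QQ. tv_dist \<xi> p q) \<le> excess_dist (tv_dist \<xi>) PP QQ"
  unfolding excess_dist_def
proof (rule cSUP_upper[OF p], rule bdd_aboveI2)
  fix x assume x: "x \<in> PP"
  obtain q where q: "q \<in> QQ" using Q(2) by blast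
  have "bdd_below (tv_dist \<xi> x ` QQ)"
    using x P Q(1) by (intro bdd_belowI2[of _ 0] tv_dist_nonneg) auto
  then have "(INF q\<in>QQ. tv_dist \<xi> x q) \<le> tv_dist \<xi> x q" using q by (rule cINF_lower)
  also have "\<dots> \<le> 2" using x q P Q(1) by (intro tv_dist_le_2) auto
  finally show "(INF q\<in>QQ. tv_dist \<xi> x q) \<le> 2" .
qed

lemma excess_tv_dist_nonneg:
  assumes P: "PP \<subseteq> prob_vectors" "PP \<noteq> {}" and Q: "QQ \<subseteq> prob_vectors" "QQ \<noteq> {}"
  shows "0 \<le> excess_dist (tv_dist \<xi>) PP QQ"
proof -
  obtain p where p: "p \<in> PP" using P by blast
  have "0 \<le> (INF q\<in>QQ. tv_dist \<xi> p q)"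
    using p P Q by (intro cINF_greatest tv_dist_nonneg) auto
  then show ?thesis using INF_tv_dist_le_excess_dist[OF P(1) Q p, of \<xi>] by simp
qed

text \<open>Moving from \<open>p\<close> to any \<open>q\<close> costs at most \<open>M\<close>
  times their distance. Dividing by \<open>M\<close> gives a lower bound on all these distances, so
  the infimum over \<open>q\<close> can be taken without a nearest point.\<close>

lemma worst_case_le_excess_dist:
  assumes P: "PP \<subseteq> prob_vectors" "PP \<noteq> {}" and Q: "QQ \<subseteq> prob_vectors" "QQ \<noteq> {}"
    and M: "0 < M" "\<And>j. \<bar>h (\<xi> j)\<bar> \<le> M"
  shows "worst_case \<xi> PP h \<le> worst_case \<xi> QQ h + M * excess_dist (tv_dist \<xi>) PP QQ"
  unfolding worst_case_def[of \<xi> PP]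
proof (rule cSUP_least[OF P(2)])
  fix p assume p: "p \<in> PP"
  have "(expect \<xi> p h - worst_case \<xi> QQ h) / M \<le> (INF q\<in>QQ. tv_dist \<xi> p q)"
  proof (rule cINF_greatest[OF Q(2)])
    fix q assume q: "q \<in> QQ"
    have "\<bar>expect \<xi> p h - expect \<xi> q h\<bar> \<le> M * tv_dist \<xi> p q"
      using p q P Q M by (intro expect_diff_le_tv_dist) auto
    moreover have "expect \<xi> q h \<le> worst_case \<xi> QQ h"
      unfolding worst_case_def by (rule cSUP_upper[OF q bdd_above_expect[OF Q(1)]])
    ultimately show "(expect \<xi> p h - worst_case \<xi> QQ h) / M \<le> tv_dist \<xi> p q"
      using M(1) by (simp add: divide_simps mult.commute)
  qed
  also have "\<dots> \<le> excess_dist (tv_dist \<xi>) PP QQ"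
    by (rule INF_tv_dist_le_excess_dist[OF P(1) Q p])
  finally show "expect \<xi> p h \<le> worst_case \<xi> QQ h + M * excess_dist (tv_dist \<xi>) PP QQ"
    using M(1) by (simp add: divide_simps mult.commute)
qed

lemma worst_case_diff_le_hausdorff_dist:
  assumes P: "PP \<subseteq> prob_vectors" "PP \<noteq> {}" and Q: "QQ \<subseteq> prob_vectors" "QQ \<noteq> {}"
    and M: "0 < M" "\<And>j. \<bar>h (\<xi> j)\<bar> \<le> M"
  shows "\<bar>worst_case \<xi> PP h - worst_case \<xi> QQ h\<bar> \<le> M * hausdorff_dist (tv_dist \<xi>) PP QQ"
proof -
  have "M * excess_dist (tv_dist \<xi>) PP QQ \<le> M * hausdorff_dist (tv_dist \<xi>) PP QQ"
       "M * excess_dist (tv_dist \<xi>) QQ PP \<le> M * hausdorff_dist (tv_dist \<xi>) PP QQ"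
    using M(1) by (auto simp: hausdorff_dist_def)
  then show ?thesis
    using worst_case_le_excess_dist[OF P Q M(1), of h \<xi>] worst_case_le_excess_dist[OF Q P M(1), of h \<xi>] M(2)
    by (simp add: abs_le_iff)
qed

section \<open>Continuity of worst cases and of infima over a compact set\<close>

lemma continuous_on_worst_case:
  assumes P: "PP \<subseteq> prob_vectors" "PP \<noteq> {}"
    and h: "\<And>j. continuous_on T (\<lambda>t. h t (\<xi> j))"
  shows "continuous_on T (\<lambda>t. worst_case \<xi> PP (h t))"
  unfolding continuous_on_def
proof
  fix t assume t: "t \<in> T"
  \<comment> \<open>The worst case is 1-Lipschitz for the maximal difference over the points; the
    finite sum dominates that maximum and tends to 0.\<close>
  have "((\<lambda>u. \<Sum>j\<in>UNIV. \<bar>h u (\<xi> j) - h t (\<xi> j)\<bar>) \<longlongrightarrow> (\<Sum>j\<in>UNIV. \<bar>h t (\<xi> j) - h t (\<xi> j)\<bar>)) (at t within T)"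
    by (intro tendsto_intros) (use h t in \<open>auto simp: continuous_on_def\<close>)
  then have lim: "((\<lambda>u. \<Sum>j\<in>UNIV. \<bar>h u (\<xi> j) - h t (\<xi> j)\<bar>) \<longlongrightarrow> 0) (at t within T)" by simp
  have "\<bar>worst_case \<xi> PP (h u) - worst_case \<xi> PP (h t)\<bar> \<le> (\<Sum>j\<in>UNIV. \<bar>h u (\<xi> j) - h t (\<xi> j)\<bar>)" for u
    by (rule worst_case_diff_le[OF P]) (rule member_le_sum, auto)
  then have "((\<lambda>u. worst_case \<xi> PP (h u) - worst_case \<xi> PP (h t)) \<longlongrightarrow> 0) (at t within T)"
    by (intro Lim_null_comparison[OF _ lim]) auto
  then show "((\<lambda>u. worst_case \<xi> PP (h u)) \<longlongrightarrow> worst_case \<xi> PP (h t)) (at t within T)"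
    using LIM_zero_iff by blast
qed

lemma INF_diff_le:
  fixes f f' :: "'a \<Rightarrow> real"
  assumes "A \<noteq> {}" "bdd_below (f ` A)" "bdd_below (f' ` A)" and "\<And>a. a \<in> A \<Longrightarrow> \<bar>f a - f' a\<bar> \<le> d"
  shows "\<bar>(INF a\<in>A. f a) - (INF a\<in>A. f' a)\<bar> \<le> d"
proof -
  have "(INF a\<in>A. f a) - d \<le> (INF a\<in>A. f' a)"
    by (rule cINF_greatest[OF assms(1)]) (use assms(2,4) cINF_lower[of f A] in fastforce)
  moreover have "(INF a\<in>A. f' a) - d \<le> (INF a\<in>A. f a)"
    by (rule cINF_greatest[OF assms(1)]) (use assms(3,4) cINF_lower[of f' A] in fastforce)
  ultimately show ?thesis by linarith
qed

text \<open>Compactness of \<open>A\<close> makes continuity at \<open>s\<close> uniform in the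
  action, so \<open>INF_diff_le\<close> passes it to the infima; halving \<open>e\<close> restores
  the strict inequality.\<close>

lemma continuous_on_INF_compact:
  fixes f :: "'s::topological_space \<Rightarrow> 'a::topological_space \<Rightarrow> real"
  assumes f: "continuous_on (S \<times> A) (\<lambda>(s, a). f s a)" and A: "compact A" "A \<noteq> {}"
  shows "continuous_on S (\<lambda>s. INF a\<in>A. f s a)"
  unfolding continuous_on_def
proof (intro ballI tendstoI)
  fix s and e :: real assume s: "s \<in> S" and e: "0 < e"
  have bdd: "bdd_below (f u ` A)" if "u \<in> S" for u
  proof -
    have "continuous_on A (\<lambda>a. case (u, a) of (s, a) \<Rightarrow> f s a)"
      by (rule continuous_on_compose2[OF f, of A "\<lambda>a. (u, a)"])
        (use that in \<open>auto intro!: continuous_on_Pair\<close>)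
    then have "continuous_on A (f u)" by simp
    then show ?thesis
      using A(1) by (intro bounded_imp_bdd_below compact_imp_bounded compact_continuous_image)
  qed
  obtain X where X: "s \<in> X" "open X"
    and close: "\<forall>u\<in>X \<inter> S. \<forall>a\<in>A. dist (case (u, a) of (s, a) \<Rightarrow> f s a) (case (s, a) of (s, a) \<Rightarrow> f s a) \<le> e / 2"
    using continuous_on_prod_compactE[OF f A(1) s, of "e / 2"] e by (metis half_gt_zero)
  have "dist (INF a\<in>A. f u a) (INF a\<in>A. f s a) < e" if "u \<in> X" "u \<in> S" for u
  proof -
    have "\<bar>(INF a\<in>A. f u a) - (INF a\<in>A. f s a)\<bar> \<le> e / 2"
      using close that s by (intro INF_diff_le A bdd) (auto simp: dist_real_def)
    then show ?thesis using e by (simp add: dist_real_def)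
  qed
  then show "\<forall>\<^sub>F u in at s within S. dist (INF a\<in>A. f u a) (INF a\<in>A. f s a) < e"
    using X by (auto simp: eventually_at_topological)
qed

subsection \<open>The robust Bellman equation\<close>

text \<open>No ambiguity set is fixed here, so that two of them can be compared within one
  model.\<close>

locale robust_mdp =
  fixes S :: "'s::topological_space set" and A :: "'a::metric_space set"
    and \<xi> :: "'j::finite \<Rightarrow> 'x::real_vector"
    and C :: "'s \<Rightarrow> 'a \<Rightarrow> 'x \<Rightarrow> real" and g :: "'s \<Rightarrow> 'a \<Rightarrow> 'x \<Rightarrow> 's"
    and w :: "'s \<Rightarrow> real" and \<gamma> \<kappa> B :: real
  assumes S: "S \<noteq> {}" and A: "compact A" "A \<noteq> {}"
    and g_maps: "\<And>s a j. s \<in> S \<Longrightarrow> a \<in> A \<Longrightarrow> g s a (\<xi> j) \<in> S"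
    and \<gamma>: "0 \<le> \<gamma>"
    and w: "continuous_on S w" "\<And>s. s \<in> S \<Longrightarrow> 1 \<le> w s"
    and C_cont: "\<And>j. continuous_on (S \<times> A) (\<lambda>(s, a). C s a (\<xi> j))"
    and g_cont: "\<And>j. continuous_on (S \<times> A) (\<lambda>(s, a). g s a (\<xi> j))"
    and B: "0 < B" and \<kappa>: "0 \<le> \<kappa>"
    and C_bound: "\<And>s a j. s \<in> S \<Longrightarrow> a \<in> A \<Longrightarrow> \<bar>C s a (\<xi> j)\<bar> \<le> B * w s"
    and g_bound: "\<And>s a j. s \<in> S \<Longrightarrow> a \<in> A \<Longrightarrow> w (g s a (\<xi> j)) \<le> \<kappa> * w s"
    and contraction: "\<gamma> * \<kappa> < 1"
begin

lemma w_pos: "s \<in> S \<Longrightarrow> 0 < w s"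
  using w(2)[of s] by simp

text \<open>Encodes that the weighted norm of \<open>U\<close> is at most \<open>K\<close> without
  forming the supremum.\<close>

abbreviation (input) "dominated U K \<equiv> \<forall>s\<in>S. \<bar>U s\<bar> \<le> K * w s"

lemma weighted_space_iff:
  "U \<in> weighted_space S w \<longleftrightarrow> U \<in> extensional S \<and> (\<exists>K. dominated U K)"
  using w_pos by (auto simp: weighted_space_def bdd_above_def pos_divide_le_eq)

lemma dominated_nonneg:
  assumes "dominated U K"
  shows "0 \<le> K"
proof -
  obtain s where s: "s \<in> S" using S by blast
  have "0 \<le> K * w s" using assms s by force
  then show ?thesis using w_pos[OF s] by (simp add: zero_le_mult_iff)
qed

text \<open>Applied at the least \<open>K\<close> that dominates \<open>U\<close>, the step gives \<open>K \<le> c + q K\<close>.\<close>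

lemma dominated_self_improving:
  assumes "dominated U K" and "q < 1"
    and step: "\<And>K. dominated U K \<Longrightarrow> dominated U (c + q * K)"
  shows "dominated U (c / (1 - q))"
proof -
  define K0 where "K0 = (SUP s\<in>S. \<bar>U s\<bar> / w s)"
  have bdd: "bdd_above ((\<lambda>s. \<bar>U s\<bar> / w s) ` S)"
    using assms(1) w_pos by (intro bdd_aboveI2[of _ _ K]) (auto simp: pos_divide_le_eq)
  have "\<bar>U s\<bar> / w s \<le> K0" if "s \<in> S" for s
    unfolding K0_def using that bdd by (rule cSUP_upper)
  then have K0: "dominated U K0" using w_pos by (auto simp: pos_divide_le_eq)
  have "K0 \<le> c + q * K0"
    unfolding K0_def
    by (rule cSUP_least[OF S]) (use step[OF K0] w_pos in \<open>auto simp: pos_divide_le_eq K0_def\<close>)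
  then have "K0 \<le> c / (1 - q)" using assms(2) by (simp add: pos_le_divide_eq algebra_simps)
  then show ?thesis using K0 w_pos by (meson mult_right_mono order_trans less_imp_le)
qed

text \<open>\<open>\<kappa>\<close> pays for the growth of \<open>w\<close> along a transition and
  \<open>\<gamma>\<close> is the discount; their product is the contraction modulus used
  throughout.\<close>

lemma dominated_next:
  assumes "dominated U K" "s \<in> S" "a \<in> A"
  shows "\<gamma> * \<bar>U (g s a (\<xi> j))\<bar> \<le> \<gamma> * \<kappa> * K * w s"
proof -
  have "\<bar>U (g s a (\<xi> j))\<bar> \<le> K * w (g s a (\<xi> j))"
    using assms g_maps by blast
  also have "\<dots> \<le> K * (\<kappa> * w s)"
    using dominated_nonneg[OF assms(1)] assms g_bound by (intro mult_left_mono) auto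
  finally have "\<gamma> * \<bar>U (g s a (\<xi> j))\<bar> \<le> \<gamma> * (K * (\<kappa> * w s))"
    using \<gamma> by (rule mult_left_mono)
  then show ?thesis by (simp add: mult_ac)
qed

lemma cost_to_go_bound:
  assumes "dominated U K" "s \<in> S" "a \<in> A"
  shows "\<bar>cost_to_go C g \<gamma> U s a (\<xi> j)\<bar> \<le> (B + \<gamma> * \<kappa> * K) * w s"
proof -
  have "\<bar>cost_to_go C g \<gamma> U s a (\<xi> j)\<bar> \<le> \<bar>C s a (\<xi> j)\<bar> + \<gamma> * \<bar>U (g s a (\<xi> j))\<bar>"
    unfolding cost_to_go_def
    using \<gamma> abs_triangle_ineq[of "C s a (\<xi> j)" "\<gamma> * U (g s a (\<xi> j))"] by (simp add: abs_mult)
  then show ?thesis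
    using dominated_next[OF assms, of j] C_bound[OF assms(2,3), of j] by (simp add: algebra_simps)
qed

lemma cost_to_go_diff:
  assumes "dominated (\<lambda>s. U s - U' s) K" "s \<in> S" "a \<in> A"
  shows "\<bar>cost_to_go C g \<gamma> U s a (\<xi> j) - cost_to_go C g \<gamma> U' s a (\<xi> j)\<bar> \<le> \<gamma> * \<kappa> * K * w s"
  using dominated_next[OF assms, of j] \<gamma>
  by (simp add: cost_to_go_def abs_mult flip: right_diff_distrib)

lemma continuous_on_cost_to_go:
  assumes U: "continuous_on S U"
  shows "continuous_on (S \<times> A) (\<lambda>(s, a). cost_to_go C g \<gamma> U s a (\<xi> j))"
proof -
  have "continuous_on (S \<times> A) (\<lambda>x. U (case x of (s, a) \<Rightarrow> g s a (\<xi> j)))"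
    by (rule continuous_on_compose2[OF U g_cont[of j]]) (use g_maps in auto)
  then show ?thesis
    using C_cont[of j] by (auto simp: cost_to_go_def split_beta intro!: continuous_intros)
qed

end

section \<open>Fixed point and optimal actions for one ambiguity set\<close>

locale ambiguous_mdp = robust_mdp S A \<xi> C g w \<gamma> \<kappa> B
  for S :: "'s::topological_space set" and A :: "'a::metric_space set"
    and \<xi> :: "'j::finite \<Rightarrow> 'x::real_vector" and C g w \<gamma> \<kappa> B +
  fixes PP :: "(real ^ 'j) set"
  assumes PP: "PP \<subseteq> prob_vectors" "PP \<noteq> {}"
begin

abbreviation "wc U s a \<equiv> worst_case \<xi> PP (cost_to_go C g \<gamma> U s a)"
abbreviation "bellman \<equiv> robust_bellman S A \<xi> C g \<gamma> PP"
abbreviation "opt_value \<equiv> value_function S A \<xi> C g \<gamma> w PP"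

lemma bellman_eq: "s \<in> S \<Longrightarrow> bellman U s = (INF a\<in>A. wc U s a)"
  by (simp add: robust_bellman_def)

lemma wc_bound:
  assumes "dominated U K" "s \<in> S" "a \<in> A"
  shows "\<bar>wc U s a\<bar> \<le> (B + \<gamma> * \<kappa> * K) * w s"
  by (intro abs_worst_case_le PP cost_to_go_bound assms)

lemma wc_bdd_below:
  assumes "dominated U K" "s \<in> S"
  shows "bdd_below (wc U s ` A)"
  by (rule bdd_belowI2[of _ "- ((B + \<gamma> * \<kappa> * K) * w s)"]) (use wc_bound[OF assms] in force)

lemma bellman_bound:
  assumes "dominated U K"
  shows "dominated (bellman U) (B + \<gamma> * \<kappa> * K)"
proof
  fix s assume s: "s \<in> S"
  have "\<bar>(INF a\<in>A. wc U s a) - (INF a\<in>A. 0)\<bar> \<le> (B + \<gamma> * \<kappa> * K) * w s"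
    using wc_bound[OF assms s] wc_bdd_below[OF assms s] A(2) by (intro INF_diff_le) auto
  then show "\<bar>bellman U s\<bar> \<le> (B + \<gamma> * \<kappa> * K) * w s"
    using A(2) by (simp add: bellman_eq s)
qed

text \<open>\<open>K1\<close> and \<open>K2\<close> ensure that the infima are over sets bounded
  below; the rate comes from \<open>K\<close> alone.\<close>

lemma bellman_contraction:
  assumes "dominated U K1" "dominated U' K2" "dominated (\<lambda>s. U s - U' s) K"
  shows "dominated (\<lambda>s. bellman U s - bellman U' s) (\<gamma> * \<kappa> * K)"
proof
  fix s assume s: "s \<in> S"
  show "\<bar>bellman U s - bellman U' s\<bar> \<le> \<gamma> * \<kappa> * K * w s"
    unfolding bellman_eq[OF s]
    by (intro INF_diff_le A wc_bdd_below[OF assms(1) s] wc_bdd_below[OF assms(2) s]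
          worst_case_diff_le PP cost_to_go_diff assms s)
qed

lemma continuous_on_wc:
  assumes "continuous_on S U"
  shows "continuous_on (S \<times> A) (\<lambda>(s, a). wc U s a)"
  using continuous_on_worst_case[OF PP, of "S \<times> A" "\<lambda>(s, a). cost_to_go C g \<gamma> U s a" \<xi>]
    continuous_on_cost_to_go[OF assms]
  by (simp add: split_beta)

lemma continuous_on_bellman:
  assumes "continuous_on S U"
  shows "continuous_on S (bellman U)"
  using continuous_on_INF_compact[OF continuous_on_wc[OF assms] A]
  by (subst continuous_on_cong[OF refl bellman_eq])

text \<open>Any bound on the difference improves by the factor \<open>\<gamma> * \<kappa>\<close>,
  so \<open>dominated_self_improving\<close> with \<open>c = 0\<close> forces it to vanish on
  \<open>S\<close>; off \<open>S\<close> extensionality decides.\<close>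

lemma fixed_point_unique:
  assumes U: "U \<in> weighted_space S w" "bellman U = U"
    and U': "U' \<in> weighted_space S w" "bellman U' = U'"
  shows "U = U'"
proof -
  obtain K1 K2 where K: "dominated U K1" "dominated U' K2"
    using U(1) U'(1) by (auto simp: weighted_space_iff)
  have "dominated (\<lambda>s. U s - U' s) (K1 + K2)"
    using K by (fastforce simp: distrib_right intro: order_trans[OF abs_triangle_ineq4 add_mono])
  then have "dominated (\<lambda>s. U s - U' s) (0 / (1 - \<gamma> * \<kappa>))"
    by (rule dominated_self_improving[OF _ contraction])
      (use bellman_contraction[OF K] U(2) U'(2) in simp)
  then have "U s = U' s" if "s \<in> S" for s using that by simp
  then show ?thesis
    using U(1) U'(1) by (auto simp: weighted_space_iff intro: extensionalityI)
qed

text \<open>Banach's argument is run directly on the value iterates: their weighted increments are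
  bounded by a geometric series. Uniform convergence then gives continuity, which membership in
  \<open>weighted_space\<close> does not.\<close>

lemma fixed_point_exists:
  "\<exists>U. U \<in> weighted_space S w \<and> bellman U = U \<and> continuous_on S U"
proof -
  \<comment> \<open>\<open>K\<close> solves \<open>K = B + \<gamma> * \<kappa> * K\<close>, so the
    bound \<open>K\<close> is inherited by every iterate.\<close>
  define K where "K = B / (1 - \<gamma> * \<kappa>)"
  have K: "B + \<gamma> * \<kappa> * K = K" using contraction by (simp add: K_def field_simps)
  have q: "0 \<le> \<gamma> * \<kappa>" using \<gamma> \<kappa> by simp
  define v where "v n = (bellman ^^ n) (\<lambda>s. 0)" for n
  have v_Suc: "v (Suc n) = bellman (v n)" for n by (simp add: v_def)
  have v_bound: "dominated (v n) K" for n
  proof (induction n)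
    case 0
    show ?case using B contraction w_pos by (auto simp: v_def K_def less_imp_le)
  next
    case (Suc n)
    show ?case using bellman_bound[OF Suc] by (simp add: v_Suc K)
  qed
  have v_cont: "continuous_on S (v n)" for n
    by (induction n) (simp_all add: v_Suc continuous_on_bellman, simp add: v_def)
  have v_diff: "dominated (\<lambda>s. v (Suc n) s - v n s) ((\<gamma> * \<kappa>) ^ n * K)" for n
  proof (induction n)
    case 0
    show ?case using v_bound[of 1] by (simp add: v_def)
  next
    case (Suc n)
    show ?case using bellman_contraction[OF v_bound v_bound Suc] by (simp add: v_Suc mult_ac)
  qed
  \<comment> \<open>The limit of \<open>v n s / w s\<close>, written as a telescoping series; there
    is no initial term because \<open>v 0\<close> is zero.\<close>
  define u where "u s = (\<Sum>n. (v (Suc n) s - v n s) / w s)" for s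
  have "uniform_limit S (\<lambda>n s. \<Sum>i<n. (v (Suc i) s - v i s) / w s) u sequentially"
    unfolding u_def
  proof (rule Weierstrass_m_test)
    show "norm ((v (Suc n) s - v n s) / w s) \<le> (\<gamma> * \<kappa>) ^ n * K" if "s \<in> S" for n s
      using v_diff[of n] that w_pos[OF that] by (simp add: pos_divide_le_eq)
    show "summable (\<lambda>n. (\<gamma> * \<kappa>) ^ n * K)"
      using q contraction by (intro summable_mult2 summable_geometric) auto
  qed
  moreover have "(\<Sum>i<n. (v (Suc i) s - v i s) / w s) = v n s / w s" for n s
    by (subst sum_divide_distrib[symmetric], subst sum_lessThan_telescope) (simp add: v_def)
  ultimately have lim: "uniform_limit S (\<lambda>n s. v n s / w s) u sequentially" by simp
  \<comment> \<open>Restriction to \<open>S\<close> makes \<open>U\<close> extensional, so that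
    \<open>bellman U = U\<close> can hold as an equality of functions.\<close>
  define U where "U = (\<lambda>s\<in>S. w s * u s)"
  have "continuous_on S u"
    by (rule uniform_limit_theorem[OF _ lim])
      (use v_cont w w_pos in \<open>force intro!: always_eventually continuous_intros\<close>)+
  then have "continuous_on S (\<lambda>s. w s * u s)" using w(1) by (intro continuous_intros)
  then have U_cont: "continuous_on S U"
    by (subst continuous_on_cong[where g = "\<lambda>s. w s * u s"]) (simp_all add: U_def)
  have close: "\<forall>\<^sub>F n in sequentially. dominated (\<lambda>s. v n s - U s) e" if "0 < e" for e
    using uniform_limitD[OF lim that]
  proof eventually_elim
    case (elim n)
    show ?case
    proof
      fix s assume s: "s \<in> S"
      have "v n s - U s = (v n s / w s - u s) * w s"
        using w_pos[OF s] s by (simp add: U_def field_simps)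
      then have "\<bar>v n s - U s\<bar> = \<bar>v n s / w s - u s\<bar> * w s"
        using w_pos[OF s] by (simp add: abs_mult)
      then show "\<bar>v n s - U s\<bar> \<le> e * w s"
        using elim s w_pos[OF s] by (simp add: dist_real_def less_imp_le)
    qed
  qed
  \<comment> \<open>A crude bound is enough for \<open>bellman_contraction\<close> and for
    membership in \<open>weighted_space\<close>; \<open>value_bound\<close> improves it
    later.\<close>
  have U_bound: "dominated U (K + 1)"
  proof -
    obtain n where n: "dominated (\<lambda>s. v n s - U s) 1"
      using close[of 1] by (auto simp: eventually_sequentially)
    show ?thesis using n v_bound[of n] by (fastforce simp: algebra_simps)
  qed
  have "bellman U s = U s" if s: "s \<in> S" for s
  proof -
    have "\<bar>bellman U s - U s\<bar> \<le> 0 + e" if "0 < e" for e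
    proof -
      \<comment> \<open>Both \<open>bellman U s\<close> and \<open>U s\<close> will lie within
        \<open>d * w s\<close> of \<open>v (Suc n) s\<close>, and the two errors add up to
        \<open>e\<close>.\<close>
      define d where "d = e / (2 * w s)"
      have d: "0 < d" using that w_pos[OF s] by (simp add: d_def)
      obtain n where n: "dominated (\<lambda>s. v n s - U s) d" "dominated (\<lambda>s. v (Suc n) s - U s) d"
        using close[OF d] unfolding eventually_sequentially by (meson le_SucI order_refl)
      have "\<bar>bellman (v n) s - bellman U s\<bar> \<le> \<gamma> * \<kappa> * d * w s"
        using bellman_contraction[OF v_bound U_bound n(1)] s by blast
      also have "\<dots> \<le> 1 * d * w s"
        using contraction d w_pos[OF s] by (intro mult_right_mono) auto
      finally have "\<bar>v (Suc n) s - bellman U s\<bar> \<le> d * w s" by (simp add: v_Suc)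
      moreover have "\<bar>v (Suc n) s - U s\<bar> \<le> d * w s" using n(2) s by blast
      moreover have "2 * (d * w s) = e" using w_pos[OF s] by (simp add: d_def)
      ultimately show ?thesis by linarith
    qed
    then have "\<bar>bellman U s - U s\<bar> \<le> 0" by (rule field_le_epsilon)
    then show ?thesis by simp
  qed
  then have "bellman U = U"
    by (intro extensionalityI[where A = S]) (auto simp: U_def robust_bellman_def)
  moreover have "U \<in> weighted_space S w"
    using U_bound by (auto simp: weighted_space_iff U_def)
  ultimately show ?thesis using U_cont by blast
qed

lemma value_properties:
  shows value_space: "opt_value \<in> weighted_space S w" and bellman_value: "bellman opt_value = opt_value"
    and continuous_on_value: "continuous_on S opt_value"
proof -
  obtain U where U: "U \<in> weighted_space S w" "bellman U = U" "continuous_on S U"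
    using fixed_point_exists by blast
  have "opt_value = U"
    unfolding value_function_def using U fixed_point_unique by (intro the_equality) auto
  then show "opt_value \<in> weighted_space S w" "bellman opt_value = opt_value" "continuous_on S opt_value"
    using U by auto
qed

text \<open>The Bellman equation turns any bound \<open>K\<close> into
  \<open>B + \<gamma> * \<kappa> * K\<close>, so self-improvement applies.\<close>

lemma value_bound: "dominated opt_value (B / (1 - \<gamma> * \<kappa>))"
proof -
  obtain K where "dominated opt_value K" using value_space by (auto simp: weighted_space_iff)
  then show ?thesis
    by (rule dominated_self_improving[OF _ contraction])
      (use bellman_bound[of "opt_value"] bellman_value in simp)
qed

lemma cost_to_go_value_bound:
  assumes "s \<in> S" "a \<in> A"
  shows "\<bar>cost_to_go C g \<gamma> opt_value s a (\<xi> j)\<bar> \<le> B / (1 - \<gamma> * \<kappa>) * w s"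
proof -
  have "B + \<gamma> * \<kappa> * (B / (1 - \<gamma> * \<kappa>)) = B / (1 - \<gamma> * \<kappa>)"
    using contraction by (simp add: field_simps)
  then show ?thesis using cost_to_go_bound[OF value_bound assms, of j] by simp
qed

lemma value_le_wc:
  assumes "s \<in> S" "a \<in> A"
  shows "opt_value s \<le> wc opt_value s a"
proof -
  have "(INF a\<in>A. wc opt_value s a) \<le> wc opt_value s a"
    using wc_bdd_below[OF value_bound assms(1)] assms(2) by (rule cINF_lower)
  then show ?thesis using bellman_eq[OF assms(1), of "opt_value"] by (simp add: bellman_value)
qed

lemma optimal_actions_eq:
  "optimal_actions S A \<xi> C g \<gamma> w PP s = {a\<in>A. wc opt_value s a = opt_value s}"
  by (simp add: optimal_actions_def Let_def bellman_value)

lemma continuous_on_wc_value: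
  assumes "s \<in> S"
  shows "continuous_on A (wc opt_value s)"
proof -
  have "continuous_on A (\<lambda>a. case (s, a) of (s, a) \<Rightarrow> wc opt_value s a)"
    by (rule continuous_on_compose2[OF continuous_on_wc[OF continuous_on_value], of A "\<lambda>a. (s, a)"])
      (use assms in \<open>auto intro!: continuous_on_Pair\<close>)
  then show ?thesis by simp
qed

lemma optimal_actions_nonempty:
  assumes s: "s \<in> S"
  shows "optimal_actions S A \<xi> C g \<gamma> w PP s \<noteq> {}"
proof -
  obtain a where a: "a \<in> A" "\<forall>b\<in>A. wc opt_value s a \<le> wc opt_value s b"
    using continuous_attains_inf[OF A continuous_on_wc_value[OF s]] by blast
  have "wc opt_value s a \<le> (INF a\<in>A. wc opt_value s a)"
    using a A(2) by (intro cINF_greatest) auto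
  then have "wc opt_value s a \<le> opt_value s"
    using bellman_eq[OF s, of "opt_value"] by (simp add: bellman_value)
  then show ?thesis using value_le_wc[OF s a(1)] a(1) by (auto simp: optimal_actions_eq)
qed

end

subsection \<open>Perturbation of the ambiguity set\<close>

context robust_mdp
begin

context
  fixes PP QQ :: "(real ^ 'j) set" and \<eta> :: real
  assumes PP: "PP \<subseteq> prob_vectors" "PP \<noteq> {}" and QQ: "QQ \<subseteq> prob_vectors" "QQ \<noteq> {}"
  defines "\<eta> \<equiv> hausdorff_dist (tv_dist \<xi>) PP QQ"
begin

interpretation P: ambiguous_mdp S A \<xi> C g w \<gamma> \<kappa> B PP
  by unfold_locales (use PP in auto)

interpretation Q: ambiguous_mdp S A \<xi> C g w \<gamma> \<kappa> B QQ
  by unfold_locales (use QQ in auto)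

lemma hausdorff_dist_nonneg: "0 \<le> \<eta>"
  using excess_tv_dist_nonneg[OF PP QQ, of \<xi>] by (simp add: \<eta>_def hausdorff_dist_def)

text \<open>\<open>PP\<close> is the reference set and \<open>QQ\<close> the perturbed one. The same
  integrand stands on both sides, and its bound from \<open>cost_to_go_value_bound\<close> serves as
  \<open>M\<close> in the Hausdorff estimate.\<close>

lemma wc_perturb:
  assumes "s \<in> S" "a \<in> A"
  shows "\<bar>P.wc P.opt_value s a - Q.wc P.opt_value s a\<bar> \<le> B / (1 - \<gamma> * \<kappa>) * \<eta> * w s"
proof -
  have "0 < B / (1 - \<gamma> * \<kappa>) * w s" using B contraction w_pos assms by simp
  from worst_case_diff_le_hausdorff_dist[OF PP QQ this, of "cost_to_go C g \<gamma> P.opt_value s a" \<xi>]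
  show ?thesis using P.cost_to_go_value_bound[OF assms] by (simp add: \<eta>_def mult_ac)
qed

text \<open>Insert \<open>Q.bellman P.opt_value\<close>: changing the operator costs
  \<open>wc_perturb\<close>, changing the argument contracts. Solving for the difference divides by
  \<open>1 - \<gamma> * \<kappa>\<close> a second time, hence the square.\<close>

lemma value_perturb: "dominated (\<lambda>s. P.opt_value s - Q.opt_value s) (B * \<eta> / (1 - \<gamma> * \<kappa>)\<^sup>2)"
proof -
  have step1: "\<bar>P.opt_value s - Q.bellman P.opt_value s\<bar> \<le> B / (1 - \<gamma> * \<kappa>) * \<eta> * w s" if s: "s \<in> S" for s
  proof -
    have "\<bar>P.bellman P.opt_value s - Q.bellman P.opt_value s\<bar> \<le> B / (1 - \<gamma> * \<kappa>) * \<eta> * w s"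
      unfolding P.bellman_eq[OF s] Q.bellman_eq[OF s]
      by (intro INF_diff_le A P.wc_bdd_below[OF P.value_bound s] Q.wc_bdd_below[OF P.value_bound s]
            wc_perturb s)
    then show ?thesis by (simp add: P.bellman_value)
  qed
  \<comment> \<open>The triangle inequality supplies the a priori bound from which the
    self-improvement starts.\<close>
  have K: "dominated (\<lambda>s. P.opt_value s - Q.opt_value s) (B / (1 - \<gamma> * \<kappa>) + B / (1 - \<gamma> * \<kappa>))"
    using P.value_bound Q.value_bound
    by (fastforce simp: distrib_right intro: order_trans[OF abs_triangle_ineq4 add_mono])
  have "dominated (\<lambda>s. P.opt_value s - Q.opt_value s) (B / (1 - \<gamma> * \<kappa>) * \<eta> / (1 - \<gamma> * \<kappa>))"
  proof (rule dominated_self_improving[OF K contraction])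
    fix K assume K: "dominated (\<lambda>s. P.opt_value s - Q.opt_value s) K"
    show "dominated (\<lambda>s. P.opt_value s - Q.opt_value s) (B / (1 - \<gamma> * \<kappa>) * \<eta> + \<gamma> * \<kappa> * K)"
    proof
      fix s assume s: "s \<in> S"
      have "\<bar>Q.bellman P.opt_value s - Q.bellman Q.opt_value s\<bar> \<le> \<gamma> * \<kappa> * K * w s"
        using Q.bellman_contraction[OF P.value_bound Q.value_bound K] s by blast
      then show "\<bar>P.opt_value s - Q.opt_value s\<bar> \<le> (B / (1 - \<gamma> * \<kappa>) * \<eta> + \<gamma> * \<kappa> * K) * w s"
        using step1[OF s] unfolding Q.bellman_value distrib_right by linarith
    qed
  qed
  then show ?thesis by (simp add: power2_eq_square)
qed

text \<open>Change first the ambiguity set, then the value function inside the objective; optimality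
  for \<open>QQ\<close> turns the result into \<open>Q.opt_value s\<close>, which is then compared
  with \<open>P.opt_value s\<close>.\<close>

lemma perturbed_optimal_action_near_optimal:
  assumes s: "s \<in> S" and a: "a \<in> optimal_actions S A \<xi> C g \<gamma> w QQ s"
  shows "P.wc P.opt_value s a \<le> P.opt_value s + 2 * B * w s / (1 - \<gamma> * \<kappa>)\<^sup>2 * \<eta>"
proof -
  define D where "D = B * \<eta> / (1 - \<gamma> * \<kappa>)\<^sup>2 * w s"
  have a': "a \<in> A" "Q.wc Q.opt_value s a = Q.opt_value s"
    using a by (auto simp: Q.optimal_actions_eq)
  have "\<bar>P.wc P.opt_value s a - Q.wc P.opt_value s a\<bar> \<le> (1 - \<gamma> * \<kappa>) * D"
  proof -
    have "(1 - \<gamma> * \<kappa>) * D = B / (1 - \<gamma> * \<kappa>) * \<eta> * w s"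
      using contraction by (simp add: D_def power2_eq_square)
    then show ?thesis using wc_perturb[OF s a'(1)] by simp
  qed
  moreover have "\<bar>Q.wc P.opt_value s a - Q.wc Q.opt_value s a\<bar> \<le> \<gamma> * \<kappa> * D"
    using cost_to_go_diff[OF value_perturb s a'(1)]
    by (intro worst_case_diff_le QQ) (simp add: D_def mult_ac)
  moreover have "\<bar>P.opt_value s - Q.opt_value s\<bar> \<le> D"
    using value_perturb s by (simp add: D_def)
  moreover have "(1 - \<gamma> * \<kappa>) * D + \<gamma> * \<kappa> * D + D = 2 * B * w s / (1 - \<gamma> * \<kappa>)\<^sup>2 * \<eta>"
  proof -
    have "(1 - \<gamma> * \<kappa>) * D + \<gamma> * \<kappa> * D + D = 2 * D" by (simp add: algebra_simps)
    then show ?thesis by (simp add: D_def)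
  qed
  ultimately show ?thesis using a'(2) by linarith
qed

end

section \<open>Stability of the optimal actions\<close>

lemma excess_optimal_actions_le:
  assumes PP: "PP \<subseteq> prob_vectors" "PP \<noteq> {}" and QQ: "QQ \<subseteq> prob_vectors" "QQ \<noteq> {}"
    and s: "s \<in> S"
    and le: "\<And>a. a \<in> optimal_actions S A \<xi> C g \<gamma> w QQ s \<Longrightarrow>
      infdist a (optimal_actions S A \<xi> C g \<gamma> w PP s) \<le> d"
  shows "excess_dist dist (optimal_actions S A \<xi> C g \<gamma> w QQ s) (optimal_actions S A \<xi> C g \<gamma> w PP s) \<le> d"
proof -
  interpret P: ambiguous_mdp S A \<xi> C g w \<gamma> \<kappa> B PP by unfold_locales (use PP in auto)
  interpret Q: ambiguous_mdp S A \<xi> C g w \<gamma> \<kappa> B QQ by unfold_locales (use QQ in auto)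
  \<comment> \<open>Both action sets must be nonempty: one carries the supremum, and
    \<open>infdist\<close> to the empty set is 0 by convention, so it is the infimum only for
    nonempty sets.\<close>
  show ?thesis
    unfolding excess_dist_def
    by (rule cSUP_least[OF Q.optimal_actions_nonempty[OF s]])
      (use le P.optimal_actions_nonempty[OF s] in \<open>simp add: infdist_notempty\<close>)
qed

lemma optimal_actions_stable:
  assumes PP: "PP \<subseteq> prob_vectors" "PP \<noteq> {}" and s: "s \<in> S" and e: "0 < e"
  shows "\<exists>\<delta>>0. \<forall>QQ. QQ \<subseteq> prob_vectors \<longrightarrow> QQ \<noteq> {} \<longrightarrow> hausdorff_dist (tv_dist \<xi>) PP QQ < \<delta> \<longrightarrow>
    excess_dist dist (optimal_actions S A \<xi> C g \<gamma> w QQ s) (optimal_actions S A \<xi> C g \<gamma> w PP s) < e"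
proof -
  interpret P: ambiguous_mdp S A \<xi> C g w \<gamma> \<kappa> B PP by unfold_locales (use PP in auto)
  define X where "X = optimal_actions S A \<xi> C g \<gamma> w PP s"
  \<comment> \<open>Actions of \<open>A\<close> outside the compact set \<open>T\<close> are within
    \<open>e / 2\<close> of \<open>X\<close>; the half keeps their supremum strictly below
    \<open>e\<close>.\<close>
  define T where "T = {a\<in>A. e / 2 \<le> infdist a X}"
  have "T = A \<inter> {a. e / 2 \<le> infdist a X}" by (auto simp: T_def)
  then have T: "compact T"
    using A(1) by (auto intro!: compact_Int_closed closed_Collect_le continuous_intros)
  \<comment> \<open>\<open>\<beta>\<close> is the least excess over the optimal value on
    \<open>T\<close>, positive because no point of \<open>T\<close> is optimal.\<close>
  obtain \<beta> where \<beta>: "0 < \<beta>" "\<And>a. a \<in> T \<Longrightarrow> P.opt_value s + \<beta> \<le> P.wc P.opt_value s a"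
  proof (cases "T = {}")
    case True
    then show ?thesis using that[of 1] by simp
  next
    case False
    have "continuous_on T (P.wc P.opt_value s)"
      using P.continuous_on_wc_value[OF s] by (rule continuous_on_subset) (auto simp: T_def)
    then obtain a where a: "a \<in> T" "\<forall>b\<in>T. P.wc P.opt_value s a \<le> P.wc P.opt_value s b"
      using continuous_attains_inf[OF T False] by blast
    have "a \<in> A" using a by (simp add: T_def)
    moreover have "a \<notin> X" using a(1) e by (auto simp: T_def)
    ultimately have "P.opt_value s < P.wc P.opt_value s a"
      using P.value_le_wc[OF s, of a] by (auto simp: X_def P.optimal_actions_eq)
    then show ?thesis using a(2) that[of "P.wc P.opt_value s a - P.opt_value s"] by auto
  qed
  \<comment> \<open>With the constant of \<open>perturbed_optimal_action_near_optimal\<close>, a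
    distance below \<open>\<beta> / M\<close> keeps perturbed optimal actions out of
    \<open>T\<close>. Neither \<open>\<beta>\<close> nor \<open>M\<close> depends on
    \<open>QQ\<close>.\<close>
  define M where "M = 2 * B * w s / (1 - \<gamma> * \<kappa>)\<^sup>2"
  have M: "0 < M" using B w_pos[OF s] contraction by (simp add: M_def)
  show ?thesis
  proof (intro exI[of _ "\<beta> / M"] conjI allI impI)
    show "0 < \<beta> / M" using \<beta> M by simp
    fix QQ :: "(real ^ 'j) set"
    assume QQ: "QQ \<subseteq> prob_vectors" "QQ \<noteq> {}" and d: "hausdorff_dist (tv_dist \<xi>) PP QQ < \<beta> / M"
    have "infdist a X \<le> e / 2" if a: "a \<in> optimal_actions S A \<xi> C g \<gamma> w QQ s" for a
    proof -
      have "P.wc P.opt_value s a \<le> P.opt_value s + M * hausdorff_dist (tv_dist \<xi>) PP QQ"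
        using perturbed_optimal_action_near_optimal[OF PP QQ s a] by (simp add: M_def)
      also have "\<dots> < P.opt_value s + \<beta>" using d M by (simp add: pos_less_divide_eq mult.commute)
      finally have "a \<notin> T" using \<beta>(2)[of a] by auto
      then show ?thesis using a by (auto simp: T_def optimal_actions_def Let_def)
    qed
    then have "excess_dist dist (optimal_actions S A \<xi> C g \<gamma> w QQ s) X \<le> e / 2"
      unfolding X_def by (intro excess_optimal_actions_le PP QQ s)
    then show "excess_dist dist (optimal_actions S A \<xi> C g \<gamma> w QQ s)
        (optimal_actions S A \<xi> C g \<gamma> w PP s) < e"
      using e by (simp add: X_def)
  qed
qed

text \<open>For a perturbed optimal action, growth bounds the excess cost below and near-optimality
  bounds it above; divide by \<open>\<nu>\<close> and take the root.\<close>

lemma optimal_actions_quantitative: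
  assumes PP: "PP \<subseteq> prob_vectors" "PP \<noteq> {}" and QQ: "QQ \<subseteq> prob_vectors" "QQ \<noteq> {}"
    and s: "s \<in> S" and \<nu>: "0 < \<nu>"
    and growth: "\<And>a. a \<in> A \<Longrightarrow> value_function S A \<xi> C g \<gamma> w PP s
        + \<nu> * (infdist a (optimal_actions S A \<xi> C g \<gamma> w PP s))\<^sup>2
      \<le> worst_case \<xi> PP (cost_to_go C g \<gamma> (value_function S A \<xi> C g \<gamma> w PP) s a)"
  shows "excess_dist dist (optimal_actions S A \<xi> C g \<gamma> w QQ s) (optimal_actions S A \<xi> C g \<gamma> w PP s)
    \<le> sqrt (2 * B * w s / (\<nu> * (1 - \<gamma> * \<kappa>)\<^sup>2) * hausdorff_dist (tv_dist \<xi>) PP QQ)"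
proof (rule excess_optimal_actions_le[OF PP QQ s])
  fix a assume a: "a \<in> optimal_actions S A \<xi> C g \<gamma> w QQ s"
  then have "a \<in> A" by (auto simp: optimal_actions_def Let_def)
  then have "\<nu> * (infdist a (optimal_actions S A \<xi> C g \<gamma> w PP s))\<^sup>2
      \<le> 2 * B * w s / (1 - \<gamma> * \<kappa>)\<^sup>2 * hausdorff_dist (tv_dist \<xi>) PP QQ"
    using growth[of a] perturbed_optimal_action_near_optimal[OF PP QQ s a] by linarith
  then have "(infdist a (optimal_actions S A \<xi> C g \<gamma> w PP s))\<^sup>2
      \<le> 2 * B * w s / (1 - \<gamma> * \<kappa>)\<^sup>2 * hausdorff_dist (tv_dist \<xi>) PP QQ / \<nu>"
    using \<nu> by (subst pos_le_divide_eq) (simp_all add: mult.commute)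
  then show "infdist a (optimal_actions S A \<xi> C g \<gamma> w PP s)
      \<le> sqrt (2 * B * w s / (\<nu> * (1 - \<gamma> * \<kappa>)\<^sup>2) * hausdorff_dist (tv_dist \<xi>) PP QQ)"
    by (intro real_le_rsqrt) (simp add: mult_ac)
qed

end

subsection \<open>The estimated ambiguity sets\<close>

text \<open>By reflection \<open>{..x}\<close> and \<open>{-x..}\<close> have equal mass, and for
  negative \<open>x\<close> they are disjoint.\<close>

lemma cdf_std_normal_neg:
  assumes "x < 0"
  shows "cdf std_normal_distribution x \<le> 1 / 2"
proof -
  interpret real_distribution std_normal_distribution by (rule real_dist_normal_dist)
  have "emeasure std_normal_distribution {..x} =
      (\<integral>\<^sup>+ t. ennreal (std_normal_density t) * indicator {..x} t \<partial>lborel)"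
    by (rule emeasure_density) auto
  also have "\<dots> = (\<integral>\<^sup>+ t. ennreal (std_normal_density (- t)) * indicator {..x} (- t) \<partial>lborel)"
    by (subst nn_integral_real_affine[where c = "-1" and t = 0]) auto
  also have "\<dots> = (\<integral>\<^sup>+ t. ennreal (std_normal_density t) * indicator {-x..} t \<partial>lborel)"
    by (intro nn_integral_cong) (auto simp: std_normal_density_def indicator_def)
  also have "\<dots> = emeasure std_normal_distribution {-x..}"
    by (rule emeasure_density[symmetric]) auto
  finally have "prob {..x} = prob {-x..}" by (simp add: measure_def)
  moreover have "prob {..x} + prob {-x..} = prob ({..x} \<union> {-x..})"
    using assms by (intro finite_measure_Union[symmetric]) auto
  moreover have "prob ({..x} \<union> {-x..}) \<le> 1" by simp
  ultimately show ?thesis unfolding cdf_def2 by linarith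
qed

text \<open>Needed for nonnegative box radii. A level above 1/2 excludes negative points; a level
  below 1 keeps the set under \<open>Inf\<close> nonempty.\<close>

lemma quantile_std_normal_nonneg:
  assumes "1 / 2 < p" "p < 1"
  shows "0 \<le> quantile std_normal_distribution p"
  unfolding quantile_def
proof (rule cInf_greatest)
  interpret real_distribution std_normal_distribution by (rule real_dist_normal_dist)
  have "\<forall>\<^sub>F x in at_top. p < cdf std_normal_distribution x"
    using cdf_lim_at_top_prob assms(2) by (rule order_tendstoD)
  then obtain x where "p < cdf std_normal_distribution x"
    by (meson eventually_happens trivial_limit_at_top_linorder)
  then show "{x. p \<le> cdf std_normal_distribution x} \<noteq> {}" by (auto intro: less_imp_le)
  fix x assume "x \<in> {x. p \<le> cdf std_normal_distribution x}"
  then show "0 \<le> x" using cdf_std_normal_neg[of x] assms(1) by force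
qed

lemma est_denom_pos:
  fixes \<tau> :: "real ^ 'j::finite"
  assumes "\<And>j. \<tau> $ j > 1"
  shows "0 < est_denom \<tau> N"
proof -
  have "0 < (\<Sum>k\<in>UNIV. \<tau> $ k - 1)" using assms by (intro sum_pos) auto
  then show ?thesis by (simp add: est_denom_def sum_subtractf)
qed

lemma est_p_in_prob_vectors:
  fixes \<tau> :: "real ^ 'j::finite"
  assumes \<tau>: "\<And>j. \<tau> $ j > 1" and \<xi>: "inj \<xi>" and x: "x \<in> {1..N} \<rightarrow> range \<xi>"
  shows "est_p \<xi> \<tau> N x \<in> prob_vectors"
proof -
  have d: "0 < est_denom \<tau> N" using est_denom_pos[OF \<tau>] .
  \<comment> \<open>Injectivity lets each sample match exactly one index, so the counts sum to
    \<open>N\<close>.\<close>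
  have one: "(\<Sum>j\<in>UNIV. if x i = \<xi> j then 1 else 0) = (1::real)" if i: "i \<in> {1..N}" for i
  proof -
    obtain k where "x i = \<xi> k" using funcset_mem[OF x i] by blast
    then have "x i = \<xi> j \<longleftrightarrow> j = k" for j using \<xi> by (auto simp: inj_eq)
    then show ?thesis by simp
  qed
  have "(\<Sum>j\<in>UNIV. \<Sum>i=1..N. if x i = \<xi> j then 1 else 0) = (\<Sum>i=1..N. \<Sum>j\<in>UNIV. if x i = \<xi> j then 1 else (0::real))"
    by (rule sum.swap)
  also have "\<dots> = real N" using one by simp
  finally have sum: "(\<Sum>j\<in>UNIV. est_p \<xi> \<tau> N x $ j) = 1"
    using d by (simp add: est_p_def est_denom_def sum.distrib sum_subtractf flip: sum_divide_distrib)
  have nonneg: "0 \<le> est_p \<xi> \<tau> N x $ j" for j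
    using d \<tau>[of j] by (auto simp: est_p_def intro!: divide_nonneg_pos add_nonneg_nonneg sum_nonneg)
  have "est_p \<xi> \<tau> N x $ j \<le> 1" for j
    using member_le_sum[of j UNIV "\<lambda>j. est_p \<xi> \<tau> N x $ j"] nonneg sum by simp
  then show ?thesis using sum nonneg by (simp add: prob_vectors_def)
qed

text \<open>The estimate \<open>est_p\<close> is the centre of the box and lies in it once the radii
  are nonnegative.\<close>

lemma est_ambiguity_nonempty:
  fixes \<tau> :: "real ^ 'j::finite"
  assumes \<tau>: "\<And>j. \<tau> $ j > 1" and \<alpha>: "0 < \<alpha>" "\<alpha> < 1"
    and \<xi>: "inj \<xi>" and x: "x \<in> {1..N} \<rightarrow> range \<xi>"
  shows "est_ambiguity \<xi> \<tau> \<alpha> N x \<noteq> {}"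
proof -
  define p where "p = est_p \<xi> \<tau> N x"
  have p: "p \<in> prob_vectors" unfolding p_def by (rule est_p_in_prob_vectors[OF \<tau> \<xi> x])
  \<comment> \<open>Having at least one point gives \<open>\<beta> \<le> \<alpha> < 1\<close>, so
    the level \<open>1 - \<beta> / 2\<close> is strictly between 1/2 and 1.\<close>
  define \<beta> where "\<beta> = \<alpha> / real CARD('j)"
  have "1 \<le> real CARD('j)" by (simp add: Suc_leI)
  then have "\<alpha> \<le> \<alpha> * real CARD('j)" using \<alpha>(1) by simp
  then have "0 < \<beta>" "\<beta> \<le> \<alpha>" using \<alpha>(1) by (auto simp: \<beta>_def divide_le_eq)
  then have "0 \<le> quantile std_normal_distribution (1 - \<beta> / 2)"
    using \<alpha>(2) by (intro quantile_std_normal_nonneg) auto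
  then have "0 \<le> est_r \<xi> \<tau> \<alpha> N x $ j" for j
    using p est_denom_pos[OF \<tau>, of N]
    by (auto simp: est_r_def Let_def p_def[symmetric] \<beta>_def[symmetric] prob_vectors_def
        intro!: mult_nonneg_nonneg divide_nonneg_pos)
  then have "p \<in> est_ambiguity \<xi> \<tau> \<alpha> N x"
    using p by (simp add: est_ambiguity_def box_ambiguity_def p_def)
  then show ?thesis by blast
qed

section \<open>Transfer to the estimated ambiguity sets\<close>

theorem theorem6:
  fixes S :: "(real ^ 'm) set" and A :: "(real ^ 'n) set"
    and \<xi> :: "'j::finite \<Rightarrow> real ^ 'k"
    and C :: "real ^ 'm \<Rightarrow> real ^ 'n \<Rightarrow> real ^ 'k \<Rightarrow> real"
    and g :: "real ^ 'm \<Rightarrow> real ^ 'n \<Rightarrow> real ^ 'k \<Rightarrow> real ^ 'm"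
    and w :: "real ^ 'm \<Rightarrow> real"
    and \<gamma> \<kappa>\<^sub>w C\<^sub>w \<gamma>\<^sub>w \<alpha> :: real
    and \<tau> :: "real ^ 'j"
    and N :: nat
    and xhat :: "nat \<Rightarrow> real ^ 'k"
    and \<PP> :: "(nat \<Rightarrow> real ^ 'k) \<Rightarrow> (real ^ 'j) set"
    and V :: "(nat \<Rightarrow> real ^ 'k) \<Rightarrow> real ^ 'm \<Rightarrow> real"
    and Opt :: "(nat \<Rightarrow> real ^ 'k) \<Rightarrow> real ^ 'm \<Rightarrow> (real ^ 'n) set"
  assumes S: "closed S" "S \<noteq> {}"
    and A: "closed A" "A \<noteq> {}" "compact A"
    and \<xi>: "inj \<xi>"
    and g_maps: "\<And>s a x. s \<in> S \<Longrightarrow> a \<in> A \<Longrightarrow> x \<in> range \<xi> \<Longrightarrow> g s a x \<in> S"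
    and \<gamma>: "0 \<le> \<gamma>" "\<gamma> < 1"
    and \<tau>: "\<And>j. \<tau> $ j > 1"
    and \<alpha>: "0 < \<alpha>" "\<alpha> < 1"
    and w: "continuous_on S w" "\<And>s. s \<in> S \<Longrightarrow> 1 \<le> w s"
    and C_cont: "\<And>x. x \<in> range \<xi> \<Longrightarrow> continuous_on (S \<times> A) (\<lambda>(s, a). C s a x)"
    and g_cont: "\<And>x. x \<in> range \<xi> \<Longrightarrow> continuous_on (S \<times> A) (\<lambda>(s, a). g s a x)"
    and C\<^sub>w: "0 < C\<^sub>w"
    and \<kappa>\<^sub>w: "0 \<le> \<kappa>\<^sub>w"
    and C_bound: "\<And>s a x. s \<in> S \<Longrightarrow> a \<in> A \<Longrightarrow> x \<in> range \<xi> \<Longrightarrow> \<bar>C s a x\<bar> \<le> C\<^sub>w * w s"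
    and g_bound: "\<And>s a x. s \<in> S \<Longrightarrow> a \<in> A \<Longrightarrow> x \<in> range \<xi> \<Longrightarrow> w (g s a x) \<le> \<kappa>\<^sub>w * w s"
    and \<gamma>\<^sub>w: "\<gamma>\<^sub>w = \<gamma> * \<kappa>\<^sub>w" "\<gamma>\<^sub>w < 1"
    and xhat: "xhat \<in> {1..N} \<rightarrow> range \<xi>"
    and \<PP>: "\<And>x. \<PP> x = est_ambiguity \<xi> \<tau> \<alpha> N x"
    and V: "\<And>x. V x = value_function S A \<xi> C g \<gamma> w (\<PP> x)"
    and Opt: "\<And>x. Opt x = optimal_actions S A \<xi> C g \<gamma> w (\<PP> x)"
  shows
    "(\<forall>\<epsilon>>0. \<forall>s\<in>S. \<exists>\<delta>>0. \<forall>xtil \<in> {1..N} \<rightarrow> range \<xi>.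
        hausdorff_dist (tv_dist \<xi>) (\<PP> xhat) (\<PP> xtil) < \<delta> \<longrightarrow>
        excess_dist dist (Opt xtil s) (Opt xhat s) < \<epsilon>)
     \<and>
     (\<forall>s\<in>S. \<forall>\<nu>>0.
        (\<forall>a\<in>A. worst_case \<xi> (\<PP> xhat) (cost_to_go C g \<gamma> (V xhat) s a)
                  \<ge> V xhat s + \<nu> * (infdist a (Opt xhat s))\<^sup>2) \<longrightarrow>
        (\<forall>xtil \<in> {1..N} \<rightarrow> range \<xi>.
           excess_dist dist (Opt xtil s) (Opt xhat s)
             \<le> sqrt (3 * C\<^sub>w * w s / (\<nu> * (1 - \<gamma>\<^sub>w)\<^sup>2)
                     * hausdorff_dist (tv_dist \<xi>) (\<PP> xhat) (\<PP> xtil))))"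
proof -
  have amb: "\<PP> x \<subseteq> prob_vectors" "\<PP> x \<noteq> {}" if "x \<in> {1..N} \<rightarrow> range \<xi>" for x
    using est_ambiguity_nonempty[OF \<tau> \<alpha> \<xi> that]
    by (auto simp: \<PP> est_ambiguity_def box_ambiguity_def)
  interpret robust_mdp S A \<xi> C g w \<gamma> \<kappa>\<^sub>w C\<^sub>w
    by unfold_locales
      (use S A g_maps \<gamma> w C_cont g_cont C\<^sub>w \<kappa>\<^sub>w C_bound g_bound \<gamma>\<^sub>w in auto)
  \<comment> \<open>In \<open>optimal_actions_stable\<close> the set \<open>QQ\<close> is quantified
    after \<open>\<delta>\<close>, so one \<open>\<delta>\<close> serves every
    \<open>xtil\<close>.\<close>
  have "\<exists>\<delta>>0. \<forall>xtil \<in> {1..N} \<rightarrow> range \<xi>.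
      hausdorff_dist (tv_dist \<xi>) (\<PP> xhat) (\<PP> xtil) < \<delta> \<longrightarrow>
      excess_dist dist (Opt xtil s) (Opt xhat s) < \<epsilon>" if "\<epsilon> > 0" "s \<in> S" for \<epsilon> s
    using optimal_actions_stable[OF amb[OF xhat] that(2,1)] amb unfolding Opt by meson
  moreover have "excess_dist dist (Opt xtil s) (Opt xhat s)
      \<le> sqrt (3 * C\<^sub>w * w s / (\<nu> * (1 - \<gamma>\<^sub>w)\<^sup>2) * hausdorff_dist (tv_dist \<xi>) (\<PP> xhat) (\<PP> xtil))"
    if s: "s \<in> S" and \<nu>: "\<nu> > 0"
      and growth: "\<forall>a\<in>A. worst_case \<xi> (\<PP> xhat) (cost_to_go C g \<gamma> (V xhat) s a)
        \<ge> V xhat s + \<nu> * (infdist a (Opt xhat s))\<^sup>2"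
      and xtil: "xtil \<in> {1..N} \<rightarrow> range \<xi>" for s \<nu> xtil
  proof -
    have "excess_dist dist (Opt xtil s) (Opt xhat s)
        \<le> sqrt (2 * C\<^sub>w * w s / (\<nu> * (1 - \<gamma>\<^sub>w)\<^sup>2) * hausdorff_dist (tv_dist \<xi>) (\<PP> xhat) (\<PP> xtil))"
      unfolding Opt \<gamma>\<^sub>w(1)
      by (rule optimal_actions_quantitative[OF amb[OF xhat] amb[OF xtil] s \<nu>])
        (use growth in \<open>simp add: V Opt\<close>)
    \<comment> \<open>The argument yields the constant 2; enlarging it to 3 is monotone since the
      Hausdorff distance and the remaining factors are nonnegative.\<close>
    also have "\<dots> \<le> sqrt (3 * C\<^sub>w * w s / (\<nu> * (1 - \<gamma>\<^sub>w)\<^sup>2)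
        * hausdorff_dist (tv_dist \<xi>) (\<PP> xhat) (\<PP> xtil))"
      using hausdorff_dist_nonneg[OF amb[OF xhat] amb[OF xtil]] C\<^sub>w w_pos[OF s] \<nu>
      by (intro real_sqrt_le_mono mult_right_mono divide_right_mono) auto
    finally show ?thesis .
  qed
  ultimately show ?thesis by blast
qed

end
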